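(* Let $n\ge3$ and let $\varphi$ be a $\frac12$-derivation of the Lie algebra $\mathfrak{r}_{2n+2}$. Then there are complex numbers $a,b$ such that $$\varphi(e_i)=ae_i\ (1\le i\le 2n),\quad \varphi(x_1)=(2n+1)be_{2n}+ax_1,\quad \varphi(x_2)=2be_{2n}+ax_2.$$
   Context: All algebras are over $\mathbb{C}$. A $\frac12$-derivation of a Lie algebra $(\mathfrak{L},[-,-])$ is a linear map $\varphi:\mathfrak{L}\to\mathfrak{L}$ with $\varphi([u,v])=\frac12([\varphi(u),v]+[u,\varphi(v)])$ for all $u,v\in\mathfrak{L}$. $\mathfrak{r}_{2n+2}$ is the $(2n+2)$-dimensional Lie algebra with basis $e_1,\dots,e_{2n},x_1,x_2$ and brackets $[e_i,e_1]=e_{i+1}$ for $2\le i\le 2n-2$; $[e_i,e_{2n+1-i}]=(-1)^ie_{2n}$ for $2\le i\le n$; $[e_i,x_1]=ie_i$ for $1\le i\le 2n-1$; $[e_{2n},x_1]=(2n+1)e_{2n}$; $[e_i,x_2]=e_i$ for $2\le i\le 2n-1$; $[e_{2n},x_2]=2e_{2n}$; brackets of basis elements not determined by these and antisymmetry are zero. *)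

theory Defs
  imports Complex_Main
begin

locale complex_lie_algebra = vector_space scale
  for scale :: "complex \<Rightarrow> 'v::ab_group_add \<Rightarrow> 'v" (infixr "*\<^sub>C" 75) +
  fixes bracket :: "'v \<Rightarrow> 'v \<Rightarrow> 'v"
  assumes linear_left: "Vector_Spaces.linear scale scale (\<lambda>u. bracket u v)"
    and linear_right: "Vector_Spaces.linear scale scale (bracket u)"
    and alternating: "bracket u u = 0"
    and jacobi: "bracket u (bracket v w) + bracket v (bracket w u) + bracket w (bracket u v) = 0"
begin

definition half_derivation :: "('v \<Rightarrow> 'v) \<Rightarrow> bool" where
  "half_derivation \<phi> \<longleftrightarrow>
     Vector_Spaces.linear scale scale \<phi> \<and>
     (\<forall>u v. \<phi> (bracket u v) = (1 / 2) *\<^sub>C (bracket (\<phi> u) v + bracket u (\<phi> v)))"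

end

locale r_basis = vector_space scale
  for scale :: "complex \<Rightarrow> 'v::ab_group_add \<Rightarrow> 'v" (infixr "*\<^sub>C" 75) +
  fixes n :: nat and e :: "nat \<Rightarrow> 'v" and x1 x2 :: 'v
  assumes inj_e: "inj_on e {1..2*n}"
    and x1_notin: "x1 \<notin> e ` {1..2*n}"
    and x2_notin: "x2 \<notin> insert x1 (e ` {1..2*n})"
    and independent_basis: "independent (insert x2 (insert x1 (e ` {1..2*n})))"
    and span_basis: "span (insert x2 (insert x1 (e ` {1..2*n}))) = UNIV"

text \<open>
  The Lie algebra of dimension \<open>2n+2\<close> given by its multiplication table. Only one order of each
  pair of basis vectors is listed; the other one follows from \<open>alternating\<close>. The facts named
  \<open>zero\<close> spell out the convention that all unlisted brackets vanish. The values \<open>e i\<close> for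
  \<open>i\<close> outside \<open>{1..2n}\<close> play no role.
\<close>
locale r_algebra = complex_lie_algebra scale bracket + r_basis scale n e x1 x2
  for scale :: "complex \<Rightarrow> 'v::ab_group_add \<Rightarrow> 'v" (infixr "*\<^sub>C" 75)
    and bracket :: "'v \<Rightarrow> 'v \<Rightarrow> 'v"
    and n :: nat and e :: "nat \<Rightarrow> 'v" and x1 x2 :: 'v +
  assumes e_e1: "\<lbrakk>2 \<le> i; i \<le> 2*n - 2\<rbrakk> \<Longrightarrow> bracket (e i) (e 1) = e (i + 1)"
    and e_e: "\<lbrakk>2 \<le> i; i \<le> n\<rbrakk> \<Longrightarrow> bracket (e i) (e (2*n + 1 - i)) = (-1) ^ i *\<^sub>C e (2*n)"
    and e_x1: "\<lbrakk>1 \<le> i; i \<le> 2*n - 1\<rbrakk> \<Longrightarrow> bracket (e i) x1 = of_nat i *\<^sub>C e i"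
    and e2n_x1: "bracket (e (2*n)) x1 = of_nat (2*n + 1) *\<^sub>C e (2*n)"
    and e_x2: "\<lbrakk>2 \<le> i; i \<le> 2*n - 1\<rbrakk> \<Longrightarrow> bracket (e i) x2 = e i"
    and e2n_x2: "bracket (e (2*n)) x2 = 2 *\<^sub>C e (2*n)"
    and zero_e_e1: "i \<in> {2*n - 1, 2*n} \<Longrightarrow> bracket (e i) (e 1) = 0"
    and zero_e_e: "\<lbrakk>i \<in> {2..2*n}; j \<in> {2..2*n}; i + j \<noteq> 2*n + 1\<rbrakk> \<Longrightarrow> bracket (e i) (e j) = 0"
    and zero_e1_x2: "bracket (e 1) x2 = 0"
    and zero_x1_x2: "bracket x1 x2 = 0"

end

theory Submission
  imports Defs
begin

text \<open>
  Since \<open>[x\<^sub>1, x\<^sub>2] = 0\<close>, the coordinates of \<open>\<phi> x\<^sub>1\<close> and \<open>\<phi> x\<^sub>2\<close> on the weight vectors \<open>e\<^sub>i\<close> are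
  proportional. Applying the derivation identity to \<open>[e\<^sub>1, x\<^sub>k]\<close> and \<open>[e\<^sub>2, x\<^sub>k]\<close> and comparing
  coordinates then kills everything in \<open>\<phi> x\<^sub>k\<close> except the \<open>e\<^sub>2\<^sub>n\<close>-part and the torus part, and
  makes \<open>e\<^sub>1\<close> and \<open>e\<^sub>2\<close> eigenvectors of \<open>\<phi>\<close>. The two ways of computing \<open>\<phi> e\<^sub>3\<close>, from
  \<open>[e\<^sub>2, e\<^sub>1]\<close> and from \<open>[e\<^sub>3, x\<^sub>2]\<close>, force the eigenvalues to agree, and \<open>e\<^sub>1, e\<^sub>2\<close> generate
  all \<open>e\<^sub>i\<close>.
\<close>

section \<open>Bilinearity and antisymmetry of the bracket\<close>

context complex_lie_algebra
begin

lemma bracket_add_left: "bracket (u + v) w = bracket u w + bracket v w"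
  and bracket_scale_left: "bracket (c *\<^sub>C u) w = c *\<^sub>C bracket u w"
  using linear_left[of w] by (simp_all add: Vector_Spaces.linear_iff)

lemma bracket_add_right: "bracket w (u + v) = bracket w u + bracket w v"
  and bracket_scale_right: "bracket w (c *\<^sub>C u) = c *\<^sub>C bracket w u"
  using linear_right[of w] by (simp_all add: Vector_Spaces.linear_iff)

lemma bracket_anticomm: "bracket u v = - bracket v u"
proof -
  have "bracket u v + bracket v u
      = (bracket u u + bracket v u) + (bracket u v + bracket v v)"
    by (simp add: alternating add.commute)
  also have "\<dots> = bracket (u + v) (u + v)"
    by (simp only: bracket_add_left bracket_add_right)
  also have "\<dots> = 0" by (rule alternating)
  finally have "bracket u v + bracket v u = 0" .
  then show ?thesis by (simp only: eq_neg_iff_add_eq_0)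
qed

lemma half_derivationD:
  assumes "half_derivation \<phi>"
  shows "\<phi> (c *\<^sub>C u) = c *\<^sub>C \<phi> u"
    and "\<phi> (bracket u v) = (1 / 2) *\<^sub>C (bracket (\<phi> u) v + bracket u (\<phi> v))"
  using assms by (simp_all add: half_derivation_def Vector_Spaces.linear_iff)

end

section \<open>Coordinate functionals of the basis\<close>

context r_basis
begin

abbreviation basis :: "'v set" where
  "basis \<equiv> insert x2 (insert x1 (e ` {1..2*n}))"

text \<open>The arguments of \<open>representation\<close> are swapped, so that for \<open>b\<close>
  in the basis \<open>coord b\<close> is the dual functional and can be applied to both sides of a
  vector equation.\<close>

definition coord :: "'v \<Rightarrow> 'v \<Rightarrow> complex" where
  "coord b v = representation basis v b"

lemma coord_add [simp]: "coord b (u + v) = coord b u + coord b v"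
  unfolding coord_def
  by (subst representation_add) (use independent_basis span_basis in auto)

lemma coord_scale [simp]: "coord b (c *\<^sub>C v) = c * coord b v"
  unfolding coord_def
  by (subst representation_scale) (use independent_basis span_basis in auto)

lemma coord_zero [simp]: "coord b 0 = 0"
  using coord_scale[of b 0 0] by simp

lemma coord_uminus [simp]: "coord b (- v) = - coord b v"
  using coord_scale[of b "-1" v] by simp

lemma coord_diff [simp]: "coord b (u - v) = coord b u - coord b v"
  using coord_add[of b u "- v"] by simp

lemma coord_basis: "b' \<in> basis \<Longrightarrow> coord b b' = (if b = b' then 1 else 0)"
  unfolding coord_def by (subst representation_basis[OF independent_basis]) auto

lemma coord_e [simp]:
  assumes "1 \<le> i" "i \<le> 2*n"
  shows "1 \<le> j \<Longrightarrow> j \<le> 2*n \<Longrightarrow> coord (e j) (e i) = (if i = j then 1 else 0)"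
    and "coord x1 (e i) = 0" and "coord x2 (e i) = 0"
proof -
  have i: "e i \<in> e ` {1..2*n}" using assms by (intro imageI) simp
  then have "e i \<in> basis" by blast
  note c = coord_basis[OF this]
  show "1 \<le> j \<Longrightarrow> j \<le> 2*n \<Longrightarrow> coord (e j) (e i) = (if i = j then 1 else 0)"
    unfolding c using inj_on_eq_iff[OF inj_e, of j i] assms by auto
  have "x1 \<noteq> e i" "x2 \<noteq> e i" using i x1_notin x2_notin by blast+
  then show "coord x1 (e i) = 0" "coord x2 (e i) = 0" unfolding c by simp_all
qed

lemma coord_x [simp]:
  "1 \<le> j \<Longrightarrow> j \<le> 2*n \<Longrightarrow> coord (e j) x1 = 0" "coord x1 x1 = 1" "coord x2 x1 = 0"
  "1 \<le> j \<Longrightarrow> j \<le> 2*n \<Longrightarrow> coord (e j) x2 = 0" "coord x1 x2 = 0" "coord x2 x2 = 1"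
  using x1_notin x2_notin by (auto simp: coord_basis)

lemma vec_eqI:
  assumes "\<And>i. 1 \<le> i \<Longrightarrow> i \<le> 2*n \<Longrightarrow> coord (e i) u = coord (e i) v"
    and "coord x1 u = coord x1 v" and "coord x2 u = coord x2 v"
  shows "u = v"
proof -
  have ex: "(\<Sum>b | representation basis v b \<noteq> 0. representation basis v b *\<^sub>C b) = v" for v
    by (rule sum_nonzero_representation_eq) (use independent_basis span_basis in auto)
  have "representation basis u b = representation basis v b" for b
  proof (cases "b \<in> basis")
    case True
    then show ?thesis using assms by (auto simp: coord_def)
  next
    case False
    then show ?thesis using representation_ne_zero by metis
  qed
  then have "representation basis u = representation basis v" by blast
  then show ?thesis using ex[of u] ex[of v] by simp
qed

text \<open>The set where two linear functionals agree is a subspace, and here it contains the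
  basis. This reduces each coordinate formula for a bracket to a check on basis vectors.\<close>

lemma functional_eqI:
  fixes f g :: "'v \<Rightarrow> complex"
  assumes f: "\<And>u v. f (u + v) = f u + f v" "\<And>c v. f (c *\<^sub>C v) = c * f v"
    and g: "\<And>u v. g (u + v) = g u + g v" "\<And>c v. g (c *\<^sub>C v) = c * g v"
    and "\<And>i. 1 \<le> i \<Longrightarrow> i \<le> 2*n \<Longrightarrow> f (e i) = g (e i)" "f x1 = g x1" "f x2 = g x2"
  shows "f v = g v"
proof -
  have "subspace {v. f v = g v}"
    using f g f(2)[of 0 0] g(2)[of 0 0] by (auto simp: subspace_def)
  moreover have "basis \<subseteq> {v. f v = g v}" using assms by auto
  ultimately have "span basis \<subseteq> {v. f v = g v}" by (rule span_minimal[rotated])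
  then show ?thesis using span_basis by auto
qed

end

section \<open>Brackets with \<open>x1\<close>, \<open>x2\<close>, \<open>e 1\<close> and
  \<open>e 2\<close> in coordinates\<close>

context r_algebra
begin

text \<open>The eigenvalue of bracketing \<open>e i\<close> with \<open>x1\<close> on the right. The
  exceptional value at \<open>2*n\<close> is the sum of the weights \<open>i\<close> and
  \<open>2*n + 1 - i\<close> of two vectors whose bracket is a multiple of
  \<open>e (2*n)\<close>.\<close>

definition weight1 :: "nat \<Rightarrow> complex" where
  "weight1 i = (if i = 2*n then of_nat (2*n + 1) else of_nat i)"

definition weight2 :: "nat \<Rightarrow> complex" where
  "weight2 i = (if i = 1 then 0 else if i = 2*n then 2 else 1)"

lemma bracket_e_x1: "1 \<le> i \<Longrightarrow> i \<le> 2*n \<Longrightarrow> bracket (e i) x1 = weight1 i *\<^sub>C e i"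
  using e_x1[of i] e2n_x1 by (auto simp: weight1_def)

lemma bracket_e_x2: "1 \<le> i \<Longrightarrow> i \<le> 2*n \<Longrightarrow> bracket (e i) x2 = weight2 i *\<^sub>C e i"
  using e_x2[of i] e2n_x2 zero_e1_x2 by (auto simp: weight2_def)

lemmas bracket_coord_simps =
  bracket_add_left bracket_scale_left bracket_add_right bracket_scale_right distrib_left

lemma coord_bracket_x1:
  "1 \<le> j \<Longrightarrow> j \<le> 2*n \<Longrightarrow> coord (e j) (bracket v x1) = weight1 j * coord (e j) v"
  "coord x1 (bracket v x1) = 0" "coord x2 (bracket v x1) = 0"
  by (rule functional_eqI[where v = v];
      simp add: bracket_coord_simps bracket_e_x1 alternating
        bracket_anticomm[of x2 x1] zero_x1_x2)+

lemma coord_bracket_x2: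
  "1 \<le> j \<Longrightarrow> j \<le> 2*n \<Longrightarrow> coord (e j) (bracket v x2) = weight2 j * coord (e j) v"
  "coord x1 (bracket v x2) = 0" "coord x2 (bracket v x2) = 0"
  by (rule functional_eqI[where v = v];
      simp add: bracket_coord_simps bracket_e_x2 alternating zero_x1_x2)+

lemma bracket_e1:
  assumes "1 \<le> i" "i \<le> 2*n"
  shows "bracket (e 1) (e i) = (if 2 \<le> i \<and> i \<le> 2*n - 2 then - e (i + 1) else 0)"
proof -
  consider "i = 1" | "2 \<le> i \<and> i \<le> 2*n - 2" | "2 \<le> i" "i \<in> {2*n - 1, 2*n}" "\<not> i \<le> 2*n - 2"
    using assms by fastforce
  then show ?thesis
  proof cases
    case 1 then show ?thesis by (simp add: alternating)
  next
    case 2 then show ?thesis using e_e1[of i] bracket_anticomm[of "e 1" "e i"] by simp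
  next
    case 3 then show ?thesis using zero_e_e1[of i] bracket_anticomm[of "e 1" "e i"] by simp
  qed
qed

lemma bracket_e2:
  assumes "n \<ge> 3" "1 \<le> i" "i \<le> 2*n"
  shows "bracket (e 2) (e i) = (if i = 1 then e 3 else if i = 2*n - 1 then e (2*n) else 0)"
  using e_e1[of 2] e_e[of 2] zero_e_e[of 2 i] assms by auto

text \<open>Besides sending \<open>x1\<close> to \<open>e 1\<close>, bracketing with
  \<open>e 1\<close> only shifts \<open>e i\<close> to \<open>- e (i + 1)\<close>. The shifted
  vectors run from \<open>e 3\<close> to \<open>e (2*n - 1)\<close>, so nothing lands on
  \<open>e 2\<close> or \<open>e (2*n)\<close>.\<close>

lemma coord_bracket_e1:
  assumes "n \<ge> 3"
  shows "coord (e 1) (bracket (e 1) v) = coord x1 v"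
    and "coord (e 2) (bracket (e 1) v) = 0"
    and "2 \<le> j \<Longrightarrow> j \<le> 2*n - 2 \<Longrightarrow> coord (e (j + 1)) (bracket (e 1) v) = - coord (e j) v"
    and "coord (e (2*n)) (bracket (e 1) v) = 0"
    and "coord x1 (bracket (e 1) v) = 0" "coord x2 (bracket (e 1) v) = 0"
  using assms
  by - (rule functional_eqI[where v = v];
      simp add: bracket_coord_simps bracket_e1 bracket_e_x1 bracket_e_x2 weight1_def weight2_def
        del: One_nat_def;
      auto)+

text \<open>The nonzero values on basis vectors are \<open>e 3\<close> from \<open>e 1\<close>,
  \<open>e (2*n)\<close> from \<open>e (2*n - 1)\<close>, and \<open>2\<close> and \<open>1\<close>
  times \<open>e 2\<close> from \<open>x1\<close> and \<open>x2\<close>.\<close>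

lemma coord_bracket_e2:
  assumes "n \<ge> 3"
  shows "coord (e 1) (bracket (e 2) v) = 0"
    and "coord (e 2) (bracket (e 2) v) = 2 * coord x1 v + coord x2 v"
    and "coord (e 3) (bracket (e 2) v) = coord (e 1) v"
    and "4 \<le> j \<Longrightarrow> j \<le> 2*n - 1 \<Longrightarrow> coord (e j) (bracket (e 2) v) = 0"
    and "coord (e (2*n)) (bracket (e 2) v) = coord (e (2*n - 1)) v"
    and "coord x1 (bracket (e 2) v) = 0" "coord x2 (bracket (e 2) v) = 0"
  using assms
  by - (rule functional_eqI[where v = v];
      simp add: bracket_coord_simps bracket_e2 bracket_e_x1 bracket_e_x2 weight1_def weight2_def
        del: One_nat_def;
      auto)+

section \<open>Determination of the half-derivations\<close>

lemma half_derivation_form: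
  assumes n: "n \<ge> 3" and \<phi>: "half_derivation \<phi>"
  shows "\<exists>a b. (\<forall>i\<in>{1..2*n}. \<phi> (e i) = a *\<^sub>C e i) \<and>
           \<phi> x1 = (of_nat (2*n + 1) * b) *\<^sub>C e (2*n) + a *\<^sub>C x1 \<and>
           \<phi> x2 = (2 * b) *\<^sub>C e (2*n) + a *\<^sub>C x2"
proof -
  note \<phi>_scale = half_derivationD(1)[OF \<phi>] and \<phi>_bracket = half_derivationD(2)[OF \<phi>]
  define a where "a = coord x1 (\<phi> x1)"
  \<comment> \<open>By \<open>x1x2\<close>, the \<open>e (2*n)\<close>-coordinates of
    \<open>\<phi> x1\<close> and \<open>\<phi> x2\<close> are in the ratio of the weights
    \<open>2*n + 1\<close> and \<open>2\<close>; halving the second makes \<open>b\<close> the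
    common factor.\<close>
  define b where "b = coord (e (2*n)) (\<phi> x2) / 2"

  have \<phi>_zero: "\<phi> 0 = 0" using \<phi>_scale[of 0 0] by simp

  have x1x2: "weight2 j * coord (e j) (\<phi> x1) = weight1 j * coord (e j) (\<phi> x2)"
    if "1 \<le> j" "j \<le> 2*n" for j
    using arg_cong[OF \<phi>_bracket[of x1 x2], of "coord (e j)"] that
    by (simp add: zero_x1_x2 \<phi>_zero bracket_anticomm[of x1 "\<phi> x2"] coord_bracket_x1 coord_bracket_x2)

  have coord_\<phi>_e_x1: "weight1 i * coord c (\<phi> (e i)) * 2
      = coord c (bracket (\<phi> (e i)) x1) + coord c (bracket (e i) (\<phi> x1))"
    and coord_\<phi>_e_x2: "weight2 i * coord c (\<phi> (e i)) * 2
      = coord c (bracket (\<phi> (e i)) x2) + coord c (bracket (e i) (\<phi> x2))"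
    if "1 \<le> i" "i \<le> 2*n" for c i
    using arg_cong[OF \<phi>_bracket[of "e i" x1], of "coord c"]
      arg_cong[OF \<phi>_bracket[of "e i" x2], of "coord c"] that
    by (simp_all add: bracket_e_x1 bracket_e_x2 \<phi>_scale)

  note e1x1 = coord_\<phi>_e_x1[of 1] and e1x2 = coord_\<phi>_e_x2[of 1]
    and e2x1 = coord_\<phi>_e_x1[of 2] and e2x2 = coord_\<phi>_e_x2[of 2]
  note brackets = coord_bracket_x1 coord_bracket_x2 coord_bracket_e1[OF n] coord_bracket_e2[OF n]

  have w: "weight1 1 = 1" "weight2 1 = 0" "weight1 2 = 2" "weight2 2 = 1"
    "weight1 (2*n) = of_nat (2*n + 1)" "weight2 (2*n) = 2"
    using n by (auto simp: weight1_def weight2_def)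
  have w_mid: "weight1 j = of_nat j" "weight2 j = 1" if "2 \<le> j" "j \<le> 2*n - 1" for j
    using that n by (auto simp: weight1_def weight2_def)

  \<comment> \<open>The weights of \<open>e 1\<close> are \<open>1\<close> and \<open>0\<close>, so
    \<open>x1x2\<close> settles this coordinate for \<open>\<phi> x2\<close> but leaves it open for
    \<open>\<phi> x1\<close> until \<open>d1_1\<close>.\<close>
  have d2_1: "coord (e 1) (\<phi> x2) = 0"
    using x1x2[of 1] n by (simp add: w del: One_nat_def)
  have d1_mid: "coord (e j) (\<phi> x1) = of_nat j * coord (e j) (\<phi> x2)"
    if "2 \<le> j" "j \<le> 2*n - 1" for j
    using x1x2[of j] w_mid[OF that] that by simp
  have d1_last: "coord (e (2*n)) (\<phi> x1) = of_nat (2*n + 1) * b"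
    using x1x2[of "2*n"] n unfolding w by (simp add: b_def field_simps)

  have s2: "coord x1 (\<phi> x2) = 0"
    using e1x2[of "e 1"] n by (simp add: w brackets del: One_nat_def)
  have c1: "coord (e 1) (\<phi> (e 1)) = a"
    using e1x1[of "e 1"] n by (simp add: w brackets a_def del: One_nat_def)
  have c2: "coord (e 2) (\<phi> (e 1)) = 0"
    using e1x2[of "e 2"] n by (simp add: w brackets del: One_nat_def)
  have c_last: "coord (e (2*n)) (\<phi> (e 1)) = 0"
    using e1x2[of "e (2*n)"] n by (simp add: w brackets del: One_nat_def)
  \<comment> \<open>With \<open>c\<close> and \<open>d\<close> for the two coordinates,
    \<open>x2\<close> gives \<open>c = d\<close> and \<open>x1\<close> gives
    \<open>2c = (j + 1)c - jd\<close>. Together they yield \<open>2c = c\<close>.\<close>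
  have c_d: "coord (e (j + 1)) (\<phi> (e 1)) = 0 \<and> coord (e j) (\<phi> x2) = 0"
    if j: "2 \<le> j" "j \<le> 2*n - 2" for j
  proof -
    have "coord (e (j + 1)) (\<phi> (e 1)) = coord (e j) (\<phi> x2)"
      using e1x2[of "e (j + 1)"] j n w_mid[of "j + 1"]
      by (simp add: w brackets(1-6) coord_bracket_e1(3)[OF n j] del: One_nat_def)
    moreover have "coord (e (j + 1)) (\<phi> (e 1)) * 2
        = of_nat (j + 1) * coord (e (j + 1)) (\<phi> (e 1)) - of_nat j * coord (e j) (\<phi> x2)"
      using e1x1[of "e (j + 1)"] j n w_mid[of "j + 1"] d1_mid[of j]
      by (simp add: w brackets(1-6) coord_bracket_e1(3)[OF n j] del: One_nat_def)
    ultimately show ?thesis by (simp add: algebra_simps)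
  qed
  have \<phi>_e1: "\<phi> (e 1) = a *\<^sub>C e 1"
  proof (rule vec_eqI)
    fix i :: nat assume i: "1 \<le> i" "i \<le> 2*n"
    have "coord (e i) (\<phi> (e 1)) = 0" if "i \<noteq> 1"
    proof (cases "i = 2 \<or> i = 2*n")
      case True
      then show ?thesis using c2 c_last by auto
    next
      case False
      then have "2 \<le> i - 1" "i - 1 \<le> 2*n - 2" and "i - 1 + 1 = i"
        using i that by linarith+
      then show ?thesis using c_d[of "i - 1"] by metis
    qed
    then show "coord (e i) (\<phi> (e 1)) = coord (e i) (a *\<^sub>C e 1)"
      using i c1 by (cases "i = 1") (simp_all del: One_nat_def)
  qed (use e1x1[of x1] e1x1[of x2] n in \<open>simp_all add: w brackets del: One_nat_def\<close>)

  \<comment> \<open>This index is out of reach of \<open>c_d\<close>. In the identity for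
    \<open>e 2\<close> and \<open>x2\<close>, the coordinate of \<open>\<phi> (e 2)\<close> at
    \<open>e (2*n)\<close> has coefficient \<open>2\<close> on both sides and cancels, leaving the
    claim.\<close>
  have d2_pre: "coord (e (2*n - 1)) (\<phi> x2) = 0"
    using e2x2[of "e (2*n)"] n by (simp add: w brackets)
  have d2_mid: "coord (e j) (\<phi> x2) = 0" if "1 \<le> j" "j \<le> 2*n - 1" for j
  proof -
    consider "j = 1" | "2 \<le> j" "j \<le> 2*n - 2" | "j = 2*n - 1" using \<open>1 \<le> j\<close> \<open>j \<le> 2*n - 1\<close> by fastforce
    then show ?thesis using d2_1 c_d d2_pre by cases auto
  qed
  \<comment> \<open>This turns out to be the eigenvalue on \<open>e 2\<close>; its equality with
    \<open>a\<close> is only obtained from \<open>e 3\<close>.\<close>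
  define t where "t = coord x2 (\<phi> x2)"
  have f1: "coord (e 1) (\<phi> (e 2)) = 0"
    using e2x2[of "e 1"] n by (simp add: w brackets del: One_nat_def)
  have f2: "coord (e 2) (\<phi> (e 2)) = t"
    using e2x2[of "e 2"] n by (simp add: w brackets s2 t_def)
  have f3: "coord (e 3) (\<phi> (e 2)) = 0"
    using e2x2[of "e 3"] n by (simp add: w w_mid brackets d2_1 del: One_nat_def)
  have f_mid: "coord (e j) (\<phi> (e 2)) = 0" if "4 \<le> j" "j \<le> 2*n - 1" for j
    using e2x2[of "e j"] n that w_mid[of j] by (simp add: w brackets)
  \<comment> \<open>Here \<open>x2\<close> gives no information, so \<open>x1\<close> is used: the
    two sides have coefficients \<open>4\<close> and \<open>2*n + 1\<close>, which differ.\<close>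
  have f_last: "coord (e (2*n)) (\<phi> (e 2)) = 0"
  proof -
    have "coord (e (2*n - 1)) (\<phi> x1) = 0" using d1_mid[of "2*n - 1"] d2_pre n by simp
    then have "4 * coord (e (2*n)) (\<phi> (e 2)) = of_nat (2*n + 1) * coord (e (2*n)) (\<phi> (e 2))"
      using e2x1[of "e (2*n)"] n by (simp add: w brackets del: of_nat_add of_nat_Suc of_nat_mult)
    moreover have "of_nat (2*n + 1) \<noteq> (of_nat 4 :: complex)" using n by (subst of_nat_eq_iff) presburger
    ultimately show ?thesis by simp
  qed
  have d1_1: "coord (e 1) (\<phi> x1) = 0"
    using e2x1[of "e 3"] n by (simp add: w w_mid brackets f3 del: One_nat_def)
  have t1: "2 * t = 2 * a + coord x2 (\<phi> x1)"
    using e2x1[of "e 2"] n by (simp add: w brackets f2 a_def)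
  have \<phi>_e2: "\<phi> (e 2) = t *\<^sub>C e 2"
  proof (rule vec_eqI)
    fix i :: nat assume i: "1 \<le> i" "i \<le> 2*n"
    consider "i = 1" | "i = 2" | "i = 3" | "i = 2*n" | "4 \<le> i" "i \<le> 2*n - 1"
      using i by fastforce
    then show "coord (e i) (\<phi> (e 2)) = coord (e i) (t *\<^sub>C e 2)"
      using i n f1 f2 f3 f_mid f_last by cases auto
  qed (use e2x1[of x1] e2x1[of x2] n in \<open>simp_all add: w brackets\<close>)

  have \<phi>_x2: "\<phi> x2 = (2 * b) *\<^sub>C e (2*n) + t *\<^sub>C x2"
  proof (rule vec_eqI)
    fix i :: nat assume i: "1 \<le> i" "i \<le> 2*n"
    then consider "i = 2*n" | "i \<le> 2*n - 1" by fastforce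
    then show "coord (e i) (\<phi> x2) = coord (e i) ((2 * b) *\<^sub>C e (2*n) + t *\<^sub>C x2)"
      using i d2_mid[of i] by cases (auto simp: b_def)
  qed (use n s2 in \<open>auto simp: t_def\<close>)

  \<comment> \<open>As a bracket of \<open>e 2\<close> and \<open>e 1\<close>, \<open>e 3\<close>
    gets the mean of \<open>t\<close> and \<open>a\<close>; the identity for \<open>e 3\<close> and
    \<open>x2\<close> gives the coordinate \<open>t\<close>, since \<open>e (2*n)\<close> commutes
    with \<open>e 3\<close>.\<close>
  have "\<phi> (e 3) = (1 / 2) *\<^sub>C (t *\<^sub>C e 3 + a *\<^sub>C e 3)"
    using \<phi>_bracket[of "e 2" "e 1"] e_e1[of 2] n
    by (simp add: \<phi>_e1 \<phi>_e2 bracket_scale_left bracket_scale_right del: One_nat_def)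
  then have "coord (e 3) (\<phi> (e 3)) = (t + a) / 2" using n by simp
  moreover have "coord (e 3) (bracket (e 3) (\<phi> x2)) = t"
    using \<phi>_x2 zero_e_e[of 3 "2*n"] n
    by (simp add: bracket_add_right bracket_scale_right bracket_e_x2 w_mid)
  ultimately have t: "t = a"
    using coord_\<phi>_e_x2[of 3 "e 3"] n by (simp add: coord_bracket_x2 w_mid field_simps)

  have chain: "i \<le> 2*n - 1 \<Longrightarrow> \<phi> (e i) = a *\<^sub>C e i" if "2 \<le> i" for i
    using that
  proof (induction i rule: nat_induct_at_least)
    case base
    then show ?case using \<phi>_e2 t by simp
  next
    case (Suc i)
    then have "\<phi> (e i) = a *\<^sub>C e i" and e: "bracket (e i) (e 1) = e (Suc i)"
      using e_e1[of i] by simp_all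
    with \<phi>_bracket[of "e i" "e 1"] show ?case
      by (simp add: \<phi>_e1[simplified] bracket_scale_left bracket_scale_right flip: scale_left_distrib)
  qed
  \<comment> \<open>The chain under \<open>e 1\<close> stops at \<open>e (2*n - 1)\<close>; the last
    vector is reached by bracketing that one with \<open>e 2\<close>.\<close>
  have \<phi>_last: "\<phi> (e (2*n)) = a *\<^sub>C e (2*n)"
  proof -
    have "bracket (e 2) (e (2*n - 1)) = e (2*n)" using e_e[of 2] n by simp
    moreover have "\<phi> (e 2) = a *\<^sub>C e 2" "\<phi> (e (2*n - 1)) = a *\<^sub>C e (2*n - 1)"
      using chain n by simp_all
    ultimately show ?thesis
      using \<phi>_bracket[of "e 2" "e (2*n - 1)"]
      by (simp add: bracket_scale_left bracket_scale_right flip: scale_left_distrib)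
  qed
  have "\<phi> (e i) = a *\<^sub>C e i" if i: "i \<in> {1..2*n}" for i
  proof -
    consider "i = 1" | "2 \<le> i" "i \<le> 2*n - 1" | "i = 2*n" using i by fastforce
    then show ?thesis using \<phi>_e1 chain \<phi>_last by cases auto
  qed
  moreover have "\<phi> x1 = (of_nat (2*n + 1) * b) *\<^sub>C e (2*n) + a *\<^sub>C x1"
  proof (rule vec_eqI)
    fix i :: nat assume i: "1 \<le> i" "i \<le> 2*n"
    then consider "i = 2*n" | "i = 1" | "2 \<le> i" "i \<le> 2*n - 1" by fastforce
    then show "coord (e i) (\<phi> x1) = coord (e i) ((of_nat (2*n + 1) * b) *\<^sub>C e (2*n) + a *\<^sub>C x1)"
      using i n d1_last d1_1 d1_mid[of i] d2_mid[of i] by cases auto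
  \<comment> \<open>With \<open>t = a\<close>, \<open>t1\<close> says that the
    \<open>x2\<close>-coordinate of \<open>\<phi> x1\<close> vanishes.\<close>
  qed (use n t1 t in \<open>auto simp: a_def\<close>)
  ultimately show ?thesis using \<phi>_x2 t by blast
qed

end

theorem theorem2p8:
  fixes scale :: "complex \<Rightarrow> 'v::ab_group_add \<Rightarrow> 'v"
    and bracket :: "'v \<Rightarrow> 'v \<Rightarrow> 'v"
    and n :: nat and e :: "nat \<Rightarrow> 'v" and x1 x2 :: 'v
    and \<phi> :: "'v \<Rightarrow> 'v"
  assumes "n \<ge> 3"
    and "r_algebra scale bracket n e x1 x2"
    and "complex_lie_algebra.half_derivation scale bracket \<phi>"
  shows "\<exists>a b :: complex.
           (\<forall>i\<in>{1..2*n}. \<phi> (e i) = scale a (e i)) \<and>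
           \<phi> x1 = scale (of_nat (2*n + 1) * b) (e (2*n)) + scale a x1 \<and>
           \<phi> x2 = scale (2 * b) (e (2*n)) + scale a x2"
  using r_algebra.half_derivation_form[OF assms(2) assms(1) assms(3)] .

end
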